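(* Let $A$ be a Banach algebra and $B$ a Banach $A$-bimodule. (1) If there is $a_0\in A$ such that either $A^{**}=a_0A^{**}$ and $a_0$ has the $Rw^*w$-property, or $A^{**}=A^{**}a_0$ and $a_0$ has the $Lw^*w$-property, then $Z_{B^{**}}(A^{**})=A^{**}$. (2) If there is $a_0\in A$ such that either $B^{**}=a_0B^{**}$ and $a_0$ has the $Rw^*w$-property with respect to $B$, or $B^{**}=B^{**}a_0$ and $a_0$ has the $Lw^*w$-property with respect to $B$, then $Z_{A^{**}}(B^{**})=B^{**}$.
   Context: $\pi_\ell:A\times B\to B$, $\pi_\ell(a,b)=ab$ and $\pi_r:B\times A\to B$, $\pi_r(b,a)=ba$ are the module actions. $B^*$ is an $A$-bimodule via $\langle b'a,b\rangle=\langle b',ab\rangle$, $\langle ab',b\rangle=\langle b',ba\rangle$, and $B^{**}$ via $\langle ab'',b'\rangle=\langle b'',b'a\rangle$, $\langle b''a,b'\rangle=\langle b'',ab'\rangle$ (and likewise for $B=A$). An element $a\in A$ has the $Lw^*w$-property (left-weak$^*$-to-weak property) with respect to $B$ if for every net $(b'_\alpha)\subseteq B^*$, $ab'_\alpha\to0$ weak$^*$ implies $ab'_\alpha\to0$ weakly. It has the $Rw^*w$-property with respect to $B$ if for every net $(b'_\alpha)\subseteq B^*$, $b'_\alpha a\to0$ weak$^*$ implies $b'_\alpha a\to0$ weakly. If no module is mentioned, the property is with respect to $B=A$. For a bounded bilinear $m:X\times Y\to Z$ of normed spaces: $\langle m^*(z',x),y\rangle=\langle z',m(x,y)\rangle$,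 $\langle m^{**}(y'',z'),x\rangle=\langle y'',m^*(z',x)\rangle$, $\langle m^{***}(x'',y''),z'\rangle=\langle x'',m^{**}(y'',z')\rangle$. $Z_{B^{**}}(A^{**})=\{a''\in A^{**}: b''\mapsto\pi_\ell^{***}(a'',b''),\ B^{**}\to B^{**},\text{ is weak}^*\text{-to-weak}^*\text{ continuous}\}$; $Z_{A^{**}}(B^{**})=\{b''\in B^{**}: a''\mapsto\pi_r^{***}(b'',a''),\ A^{**}\to B^{**},\text{ is weak}^*\text{-to-weak}^*\text{ continuous}\}$. *)

theory Defs
  imports "HOL-Analysis.Analysis"
begin

text \<open>
  The scalar field is a type \<open>'k\<close> of class \<^class>\<open>real_normed_field\<close>, so that the real and
  the complex case are both covered. As the library has no normed spaces over a
  field other than the reals, the scalar multiplication by \<open>'k\<close> is an explicit parameter.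
  The dual and the bidual of a space depend on that parameter and are therefore sets, not types.
\<close>

locale normed_space_over = vector_space scale
  for scale :: "'k::real_normed_field \<Rightarrow> 'a::real_normed_vector \<Rightarrow> 'a" +
  assumes norm_scale: "norm (scale c x) = norm c * norm x"
    and scale_of_real: "scale (of_real r) x = r *\<^sub>R x"

locale banach_algebra_over = normed_space_over scale
  for scale :: "'k::real_normed_field \<Rightarrow> 'a::{real_normed_algebra, banach} \<Rightarrow> 'a" +
  assumes mult_scale_left: "scale c x * y = scale c (x * y)"
    and mult_scale_right: "x * scale c y = scale c (x * y)"

locale banach_bimodule =
  A: banach_algebra_over scaleA + B: normed_space_over scaleB
  for scaleA :: "'k::real_normed_field \<Rightarrow> 'a::{real_normed_algebra, banach} \<Rightarrow> 'a"
    and scaleB :: "'k \<Rightarrow> 'b::banach \<Rightarrow> 'b" +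
  fixes lact :: "'a \<Rightarrow> 'b \<Rightarrow> 'b"
    and ract :: "'b \<Rightarrow> 'a \<Rightarrow> 'b"
  assumes bounded_bilinear_lact: "bounded_bilinear lact"
    and bounded_bilinear_ract: "bounded_bilinear ract"
    and lact_scaleA: "lact (scaleA c a) b = scaleB c (lact a b)"
    and lact_scaleB: "lact a (scaleB c b) = scaleB c (lact a b)"
    and ract_scaleA: "ract b (scaleA c a) = scaleB c (ract b a)"
    and ract_scaleB: "ract (scaleB c b) a = scaleB c (ract b a)"
    and lact_assoc: "lact (a1 * a2) b = lact a1 (lact a2 b)"
    and ract_assoc: "ract b (a1 * a2) = ract (ract b a1) a2"
    and lact_ract: "ract (lact a1 b) a2 = lact a1 (ract b a2)"

lemma normed_space_over_real:
  "normed_space_over ((*\<^sub>R) :: real \<Rightarrow> 'a::real_normed_vector \<Rightarrow> 'a)"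
  by unfold_locales (auto simp: algebra_simps)

lemma normed_space_over_field:
  "normed_space_over ((*) :: 'k::real_normed_field \<Rightarrow> 'k \<Rightarrow> 'k)"
  by unfold_locales (auto simp: algebra_simps norm_mult scaleR_conv_of_real)

lemma banach_algebra_over_real:
  "banach_algebra_over ((*\<^sub>R) :: real \<Rightarrow> 'a::{real_normed_algebra, banach} \<Rightarrow> 'a)"
  by (intro banach_algebra_over.intro normed_space_over_real banach_algebra_over_axioms.intro) auto

lemma (in banach_algebra_over) banach_bimodule_self:
  "banach_bimodule scale scale (*) (*)"
  by (intro banach_bimodule.intro banach_bimodule_axioms.intro banach_algebra_over_axioms
      normed_space_over_axioms bounded_bilinear_mult)
    (simp_all add: mult_scale_left mult_scale_right mult.assoc)


subsection \<open>Dual and bidual\<close>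

definition dual_space ::
    "('k::real_normed_field \<Rightarrow> 'a::real_normed_vector \<Rightarrow> 'a) \<Rightarrow> ('a \<Rightarrow>\<^sub>L 'k) set" where
  "dual_space sc = {f. \<forall>c x. blinfun_apply f (sc c x) = c * blinfun_apply f x}"

text \<open>
  The bounded linear functionals on the dual space, as functions that are \<^const>\<open>undefined\<close>
  outside it. \<open>blinfun_mult_right c o\<^sub>L f\<close> is the functional \<open>x \<mapsto> c * f x\<close>.
\<close>
definition bidual_space ::
    "('k::real_normed_field \<Rightarrow> 'a::real_normed_vector \<Rightarrow> 'a) \<Rightarrow> (('a \<Rightarrow>\<^sub>L 'k) \<Rightarrow> 'k) set" where
  "bidual_space sc = {\<phi> \<in> extensional (dual_space sc).
     (\<forall>f\<in>dual_space sc. \<forall>g\<in>dual_space sc. \<phi> (f + g) = \<phi> f + \<phi> g) \<and>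
     (\<forall>c. \<forall>f\<in>dual_space sc. \<phi> (blinfun_mult_right c o\<^sub>L f) = c * \<phi> f) \<and>
     (\<exists>K. \<forall>f\<in>dual_space sc. norm (\<phi> f) \<le> norm f * K)}"

definition weak_star_dual ::
    "('k::real_normed_field \<Rightarrow> 'a::real_normed_vector \<Rightarrow> 'a) \<Rightarrow> ('a \<Rightarrow>\<^sub>L 'k) topology" where
  "weak_star_dual sc =
     pullback_topology (dual_space sc) blinfun_apply (product_topology (\<lambda>_. euclidean) UNIV)"

definition weak_dual ::
    "('k::real_normed_field \<Rightarrow> 'a::real_normed_vector \<Rightarrow> 'a) \<Rightarrow> ('a \<Rightarrow>\<^sub>L 'k) topology" where
  "weak_dual sc =
     pullback_topology (dual_space sc) (\<lambda>f. \<lambda>\<phi>\<in>bidual_space sc. \<phi> f)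
       (product_topology (\<lambda>_. euclidean) (bidual_space sc))"

definition weak_star_bidual ::
    "('k::real_normed_field \<Rightarrow> 'a::real_normed_vector \<Rightarrow> 'a) \<Rightarrow> (('a \<Rightarrow>\<^sub>L 'k) \<Rightarrow> 'k) topology" where
  "weak_star_bidual sc =
     subtopology (product_topology (\<lambda>_. euclidean) (dual_space sc)) (bidual_space sc)"


subsection \<open>Adjoints of a bilinear map\<close>

text \<open>
  For \<open>m : X \<times> Y \<rightarrow> Z\<close> these are \<open>m\<^sup>* : Z\<^sup>* \<times> X \<rightarrow> Y\<^sup>*\<close>, \<open>m\<^sup>*\<^sup>* : Y\<^sup>*\<^sup>* \<times> Z\<^sup>* \<rightarrow> X\<^sup>*\<close>
  and \<open>m\<^sup>*\<^sup>*\<^sup>* : X\<^sup>*\<^sup>* \<times> Y\<^sup>*\<^sup>* \<rightarrow> Z\<^sup>*\<^sup>*\<close>.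
\<close>

definition adjoint1 ::
    "('x::real_normed_vector \<Rightarrow> 'y::real_normed_vector \<Rightarrow> 'z::real_normed_vector)
     \<Rightarrow> ('z \<Rightarrow>\<^sub>L 'k::real_normed_field) \<Rightarrow> 'x \<Rightarrow> ('y \<Rightarrow>\<^sub>L 'k)" where
  "adjoint1 m z' x = Blinfun (\<lambda>y. blinfun_apply z' (m x y))"

definition adjoint2 ::
    "('x::real_normed_vector \<Rightarrow> 'y::real_normed_vector \<Rightarrow> 'z::real_normed_vector)
     \<Rightarrow> (('y \<Rightarrow>\<^sub>L 'k) \<Rightarrow> 'k) \<Rightarrow> ('z \<Rightarrow>\<^sub>L 'k::real_normed_field) \<Rightarrow> ('x \<Rightarrow>\<^sub>L 'k)" where
  "adjoint2 m y'' z' = Blinfun (\<lambda>x. y'' (adjoint1 m z' x))"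

definition adjoint3 ::
    "('k \<Rightarrow> 'z \<Rightarrow> 'z)
     \<Rightarrow> ('x::real_normed_vector \<Rightarrow> 'y::real_normed_vector \<Rightarrow> 'z::real_normed_vector)
     \<Rightarrow> (('x \<Rightarrow>\<^sub>L 'k) \<Rightarrow> 'k) \<Rightarrow> (('y \<Rightarrow>\<^sub>L 'k) \<Rightarrow> 'k) \<Rightarrow> (('z \<Rightarrow>\<^sub>L 'k::real_normed_field) \<Rightarrow> 'k)"
  where
  "adjoint3 scaleZ m x'' y'' = (\<lambda>z'\<in>dual_space scaleZ. x'' (adjoint2 m y'' z'))"

text \<open>\<open>Z\<^bsub>B\<^sup>*\<^sup>*\<^esub>(A\<^sup>*\<^sup>*)\<close> is the case \<open>m = \<pi>\<^sub>\<ell>\<close>, and \<open>Z\<^bsub>A\<^sup>*\<^sup>*\<^esub>(B\<^sup>*\<^sup>*)\<close> is the case \<open>m = \<pi>\<^sub>r\<close>.\<close>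

definition topological_center ::
    "('k \<Rightarrow> 'x \<Rightarrow> 'x) \<Rightarrow> ('k \<Rightarrow> 'y \<Rightarrow> 'y) \<Rightarrow> ('k \<Rightarrow> 'z \<Rightarrow> 'z)
     \<Rightarrow> ('x::real_normed_vector \<Rightarrow> 'y::real_normed_vector \<Rightarrow> 'z::real_normed_vector)
     \<Rightarrow> (('x \<Rightarrow>\<^sub>L 'k::real_normed_field) \<Rightarrow> 'k) set" where
  "topological_center scaleX scaleY scaleZ m =
     {x'' \<in> bidual_space scaleX.
        continuous_map (weak_star_bidual scaleY) (weak_star_bidual scaleZ)
          (\<lambda>y''. adjoint3 scaleZ m x'' y'')}"


subsection \<open>Module actions on dual and bidual\<close>

text \<open>
  With \<open>lact a b = ab\<close> and \<open>ract b a = ba\<close>. The right action on \<open>B\<^sup>*\<close> comes from the left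
  action on \<open>B\<close> and vice versa.
\<close>

definition dual_ract ::
    "('a \<Rightarrow> 'b \<Rightarrow> 'b) \<Rightarrow> ('b::real_normed_vector \<Rightarrow>\<^sub>L 'k::real_normed_field) \<Rightarrow> 'a \<Rightarrow> ('b \<Rightarrow>\<^sub>L 'k)"
  where "dual_ract lact b' a = Blinfun (\<lambda>b. blinfun_apply b' (lact a b))"

definition dual_lact ::
    "('b \<Rightarrow> 'a \<Rightarrow> 'b) \<Rightarrow> 'a \<Rightarrow> ('b::real_normed_vector \<Rightarrow>\<^sub>L 'k::real_normed_field) \<Rightarrow> ('b \<Rightarrow>\<^sub>L 'k)"
  where "dual_lact ract a b' = Blinfun (\<lambda>b. blinfun_apply b' (ract b a))"

definition bidual_lact ::
    "('k \<Rightarrow> 'b \<Rightarrow> 'b) \<Rightarrow> ('a \<Rightarrow> 'b \<Rightarrow> 'b) \<Rightarrow> 'a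
     \<Rightarrow> (('b::real_normed_vector \<Rightarrow>\<^sub>L 'k::real_normed_field) \<Rightarrow> 'k) \<Rightarrow> (('b \<Rightarrow>\<^sub>L 'k) \<Rightarrow> 'k)"
  where "bidual_lact scaleB lact a b'' = (\<lambda>b'\<in>dual_space scaleB. b'' (dual_ract lact b' a))"

definition bidual_ract ::
    "('k \<Rightarrow> 'b \<Rightarrow> 'b) \<Rightarrow> ('b \<Rightarrow> 'a \<Rightarrow> 'b)
     \<Rightarrow> (('b::real_normed_vector \<Rightarrow>\<^sub>L 'k::real_normed_field) \<Rightarrow> 'k) \<Rightarrow> 'a \<Rightarrow> (('b \<Rightarrow>\<^sub>L 'k) \<Rightarrow> 'k)"
  where "bidual_ract scaleB ract b'' a = (\<lambda>b'\<in>dual_space scaleB. b'' (dual_lact ract a b'))"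


subsection \<open>The weak-star-to-weak properties\<close>

text \<open>
  Nets in \<open>B\<^sup>*\<close> are rendered as filters on \<open>B\<^sup>*\<close>: a net enters through the filter generated by
  its tails, and every filter arises in this way up to convergence.
\<close>

definition Lwsw_property ::
    "('k::real_normed_field \<Rightarrow> 'b::real_normed_vector \<Rightarrow> 'b) \<Rightarrow> ('b \<Rightarrow> 'a \<Rightarrow> 'b) \<Rightarrow> 'a \<Rightarrow> bool" where
  "Lwsw_property scaleB ract a \<longleftrightarrow>
     (\<forall>F. (\<forall>\<^sub>F b' in F. b' \<in> dual_space scaleB) \<longrightarrow>
        limitin (weak_star_dual scaleB) (\<lambda>b'. dual_lact ract a b') 0 F \<longrightarrow>
        limitin (weak_dual scaleB) (\<lambda>b'. dual_lact ract a b') 0 F)"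

definition Rwsw_property ::
    "('k::real_normed_field \<Rightarrow> 'b::real_normed_vector \<Rightarrow> 'b) \<Rightarrow> ('a \<Rightarrow> 'b \<Rightarrow> 'b) \<Rightarrow> 'a \<Rightarrow> bool" where
  "Rwsw_property scaleB lact a \<longleftrightarrow>
     (\<forall>F. (\<forall>\<^sub>F b' in F. b' \<in> dual_space scaleB) \<longrightarrow>
        limitin (weak_star_dual scaleB) (\<lambda>b'. dual_ract lact b' a) 0 F \<longrightarrow>
        limitin (weak_dual scaleB) (\<lambda>b'. dual_ract lact b' a) 0 F)"

end

(* The module action of a0 on X** is the second adjoint of the operator T = a0 . or T = . a0
   on X, so the hypotheses say that every x'' in X** has the form w'' o T* and that, on nets
   T* x'_i, weak* null implies weakly null. For a net y''_i -> y'' weak*, the functionals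
   m**(y''_i, z') converge to m**(y'', z') weak*, hence so do their images under T*; these then
   converge weakly, and w'' can be applied to them. *)

theory Submission
  imports Defs
begin

section \<open>First adjoint and the linear structure of dual and bidual\<close>

text \<open>\<open>Blinfun\<close> obeys its defining formula only on bounded linear maps, so the
  formula rests on boundedness of \<open>m\<close> in its second argument.\<close>

lemma adjoint1_apply:
  assumes "bounded_bilinear m"
  shows "blinfun_apply (adjoint1 m z' x) y = blinfun_apply z' (m x y)"
proof -
  have "bounded_linear (\<lambda>y. blinfun_apply z' (m x y))"
    by (intro bounded_linear_compose[OF blinfun.bounded_linear_right]
        bounded_bilinear.bounded_linear_right[OF assms])
  then show ?thesis
    by (simp add: adjoint1_def bounded_linear_Blinfun_apply)
qed

lemma adjoint1_in_dual_space:
  assumes "bounded_bilinear m" "\<And>c x y. m x (sY c y) = sZ c (m x y)" "z' \<in> dual_space sZ"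
  shows "adjoint1 m z' x \<in> dual_space sY"
  using assms by (simp add: dual_space_def adjoint1_apply)

text \<open>One constant serves all \<open>z'\<close> and \<open>x\<close>: the bound in
  \<open>x\<close> makes the second adjoint bounded, and the bound in \<open>z'\<close> later puts
  the third adjoint into the bidual.\<close>

lemma norm_adjoint1_le:
  fixes m :: "'x::real_normed_vector \<Rightarrow> 'y::real_normed_vector \<Rightarrow> 'z::real_normed_vector"
  assumes "bounded_bilinear m"
  obtains K where "K \<ge> 0"
    "\<And>(z' :: 'z \<Rightarrow>\<^sub>L 'k::real_normed_field) x. norm (adjoint1 m z' x) \<le> norm z' * norm x * K"
proof -
  obtain K where K: "K \<ge> 0" "\<And>x y. norm (m x y) \<le> norm x * norm y * K"
    using bounded_bilinear.nonneg_bounded[OF assms] by blast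
  have "norm (adjoint1 m z' x) \<le> norm z' * norm x * K"
    for z' :: "'z \<Rightarrow>\<^sub>L 'k" and x
  proof (rule norm_blinfun_bound)
    fix y
    have "norm (blinfun_apply z' (m x y)) \<le> norm z' * norm (m x y)"
      by (rule norm_blinfun)
    also have "\<dots> \<le> norm z' * (norm x * norm y * K)"
      by (intro mult_left_mono K) auto
    finally show "norm (blinfun_apply (adjoint1 m z' x) y) \<le> norm z' * norm x * K * norm y"
      by (simp add: adjoint1_apply[OF assms] mult_ac)
  qed (use K in auto)
  with K(1) show ?thesis
    using that by blast
qed

lemma dual_space_add: "f \<in> dual_space sc \<Longrightarrow> g \<in> dual_space sc \<Longrightarrow> f + g \<in> dual_space sc"
  by (simp add: dual_space_def blinfun.add_left algebra_simps)

lemma dual_space_diff: "f \<in> dual_space sc \<Longrightarrow> g \<in> dual_space sc \<Longrightarrow> f - g \<in> dual_space sc"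
  by (simp add: dual_space_def blinfun.diff_left algebra_simps)

lemma dual_space_scale: "f \<in> dual_space sc \<Longrightarrow> blinfun_mult_right c o\<^sub>L f \<in> dual_space sc"
  by (simp add: dual_space_def algebra_simps)

lemma zero_in_dual_space: "0 \<in> dual_space sc"
  by (simp add: dual_space_def)

lemma bidual_space_add:
  "\<phi> \<in> bidual_space sc \<Longrightarrow> f \<in> dual_space sc \<Longrightarrow> g \<in> dual_space sc \<Longrightarrow> \<phi> (f + g) = \<phi> f + \<phi> g"
  by (simp add: bidual_space_def)

lemma bidual_space_scale:
  "\<phi> \<in> bidual_space sc \<Longrightarrow> f \<in> dual_space sc \<Longrightarrow> \<phi> (blinfun_mult_right c o\<^sub>L f) = c * \<phi> f"
  by (simp add: bidual_space_def)

lemma bidual_space_diff: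
  assumes "\<phi> \<in> bidual_space sc" "f \<in> dual_space sc" "g \<in> dual_space sc"
  shows "\<phi> (f - g) = \<phi> f - \<phi> g"
  using bidual_space_add[OF assms(1) dual_space_diff[OF assms(2,3)] assms(3)] by simp

lemma bidual_space_zero:
  assumes "\<phi> \<in> bidual_space sc"
  shows "\<phi> 0 = 0"
  using bidual_space_diff[OF assms zero_in_dual_space zero_in_dual_space] by simp

lemma bidual_space_bounded:
  assumes "\<phi> \<in> bidual_space sc"
  obtains K where "K \<ge> 0" "\<And>f. f \<in> dual_space sc \<Longrightarrow> norm (\<phi> f) \<le> norm f * K"
proof -
  obtain K where K: "\<And>f. f \<in> dual_space sc \<Longrightarrow> norm (\<phi> f) \<le> norm f * K"
    using assms unfolding bidual_space_def by blast
  \<comment> \<open>\<open>K\<close> may be negative if the dual space is trivial, hence the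
    absolute value.\<close>
  have "norm (\<phi> f) \<le> norm f * \<bar>K\<bar>" if "f \<in> dual_space sc" for f
    by (rule order_trans[OF K[OF that]]) (simp add: mult_left_mono)
  then show ?thesis
    by (rule that[OF abs_ge_zero])
qed

section \<open>Second and third adjoint\<close>

text \<open>Again \<open>Blinfun\<close> has to be justified. \<open>y''\<close> is linear and
  bounded only on \<open>dual_space sY\<close>, so every functional fed to it must be shown to lie
  there.\<close>

lemma adjoint2_apply:
  fixes m :: "'x::real_normed_vector \<Rightarrow> 'y::real_normed_vector \<Rightarrow> 'z::real_normed_vector"
    and sZ :: "'k::real_normed_field \<Rightarrow> 'z \<Rightarrow> 'z"
  assumes "bounded_bilinear m" "\<And>c x y. m x (sY c y) = sZ c (m x y)"
    and "y'' \<in> bidual_space sY" "z' \<in> dual_space sZ"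
  shows "blinfun_apply (adjoint2 m y'' z') x = y'' (adjoint1 m z' x)"
proof -
  have dual: "adjoint1 m z' x \<in> dual_space sY" for x
    by (rule adjoint1_in_dual_space[OF assms(1,2,4)])
  obtain L where L: "L \<ge> 0"
    "\<And>(z' :: 'z \<Rightarrow>\<^sub>L 'k) x. norm (adjoint1 m z' x) \<le> norm z' * norm x * L"
    using norm_adjoint1_le[OF assms(1)] by metis
  obtain K where K: "K \<ge> 0" "\<And>f. f \<in> dual_space sY \<Longrightarrow> norm (y'' f) \<le> norm f * K"
    using bidual_space_bounded[OF assms(3)] by metis
  have "bounded_linear (\<lambda>x. y'' (adjoint1 m z' x))"
  proof (rule bounded_linear_intro)
    fix x1 x2
    have "adjoint1 m z' (x1 + x2) = adjoint1 m z' x1 + adjoint1 m z' x2"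
      by (rule blinfun_eqI) (simp add: adjoint1_apply[OF assms(1)] blinfun.add_left
          blinfun.add_right bounded_bilinear.add_left[OF assms(1)])
    then show "y'' (adjoint1 m z' (x1 + x2)) = y'' (adjoint1 m z' x1) + y'' (adjoint1 m z' x2)"
      by (simp add: bidual_space_add[OF assms(3)] dual)
  next
    fix r x
    \<comment> \<open>Homogeneity in \<open>bidual_space\<close> is phrased by composition with
      \<open>blinfun_mult_right\<close>, so the real factor is first embedded into the scalar
      field.\<close>
    have "adjoint1 m z' (r *\<^sub>R x) = blinfun_mult_right (of_real r) o\<^sub>L adjoint1 m z' x"
      by (rule blinfun_eqI) (simp add: adjoint1_apply[OF assms(1)] blinfun.scaleR_right
          bounded_bilinear.scaleR_left[OF assms(1)] scaleR_conv_of_real)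
    then show "y'' (adjoint1 m z' (r *\<^sub>R x)) = r *\<^sub>R y'' (adjoint1 m z' x)"
      by (simp add: bidual_space_scale[OF assms(3)] dual scaleR_conv_of_real)
  next
    fix x
    have "norm (y'' (adjoint1 m z' x)) \<le> norm (adjoint1 m z' x) * K"
      by (rule K(2)[OF dual])
    also have "\<dots> \<le> norm z' * norm x * L * K"
      by (intro mult_right_mono L K)
    finally show "norm (y'' (adjoint1 m z' x)) \<le> norm x * (norm z' * L * K)"
      by (simp add: mult_ac)
  qed
  then show ?thesis
    by (simp add: adjoint2_def bounded_linear_Blinfun_apply)
qed

text \<open>A member of the \<open>\<Rightarrow>\<^sub>L\<close> type is only real-linear. Linearity
  over \<open>'k\<close> comes from homogeneity of \<open>m\<close> in its first argument: the
  scalar passes through \<open>z'\<close> and then through \<open>y''\<close>.\<close>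

lemma adjoint2_in_dual_space:
  assumes "bounded_bilinear m" "\<And>c x y. m (sX c x) y = sZ c (m x y)"
    and "\<And>c x y. m x (sY c y) = sZ c (m x y)"
    and "y'' \<in> bidual_space sY" "z' \<in> dual_space sZ"
  shows "adjoint2 m y'' z' \<in> dual_space sX"
proof -
  have "adjoint1 m z' (sX c x) = blinfun_mult_right c o\<^sub>L adjoint1 m z' x" for c x
    using assms(5)
    by (intro blinfun_eqI) (simp add: adjoint1_apply[OF assms(1)] assms(2) dual_space_def)
  then show ?thesis
    using assms adjoint1_in_dual_space[OF assms(1,3,5)]
    by (simp add: dual_space_def[of sX] adjoint2_apply[OF assms(1,3-5)]
        bidual_space_scale[OF assms(4)])
qed

lemma norm_adjoint2_le:
  fixes m :: "'x::real_normed_vector \<Rightarrow> 'y::real_normed_vector \<Rightarrow> 'z::real_normed_vector"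
    and sZ :: "'k::real_normed_field \<Rightarrow> 'z \<Rightarrow> 'z"
  assumes "bounded_bilinear m" "\<And>c x y. m x (sY c y) = sZ c (m x y)" "y'' \<in> bidual_space sY"
  obtains K where "K \<ge> 0"
    "\<And>z'. z' \<in> dual_space sZ \<Longrightarrow> norm (adjoint2 m y'' z') \<le> norm z' * K"
proof -
  obtain L where L: "L \<ge> 0"
    "\<And>(z' :: 'z \<Rightarrow>\<^sub>L 'k) x. norm (adjoint1 m z' x) \<le> norm z' * norm x * L"
    using norm_adjoint1_le[OF assms(1)] by metis
  obtain K where K: "K \<ge> 0" "\<And>f. f \<in> dual_space sY \<Longrightarrow> norm (y'' f) \<le> norm f * K"
    using bidual_space_bounded[OF assms(3)] by metis
  have "norm (adjoint2 m y'' z') \<le> norm z' * (L * K)" if z': "z' \<in> dual_space sZ" for z'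
  proof (rule norm_blinfun_bound)
    fix x
    have "norm (y'' (adjoint1 m z' x)) \<le> norm (adjoint1 m z' x) * K"
      by (rule K(2)[OF adjoint1_in_dual_space[OF assms(1,2) z']])
    also have "\<dots> \<le> norm z' * norm x * L * K"
      by (intro mult_right_mono L K)
    finally show "norm (blinfun_apply (adjoint2 m y'' z') x) \<le> norm z' * (L * K) * norm x"
      by (simp add: adjoint2_apply[OF assms z'] mult_ac)
  qed (use L K in auto)
  then show ?thesis
    using that[of "L * K"] L K by simp
qed

text \<open>For fixed \<open>y''\<close> the second adjoint is a bounded linear map from Z* to X*,
  and \<open>x''\<close> is composed with it. Since \<open>weak_star_bidual\<close> is a
  subtopology, continuity into it requires this membership.\<close>

lemma adjoint3_in_bidual_space:
  assumes "bounded_bilinear m" "\<And>c x y. m (sX c x) y = sZ c (m x y)"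
    and "\<And>c x y. m x (sY c y) = sZ c (m x y)"
    and x'': "x'' \<in> bidual_space sX" and y'': "y'' \<in> bidual_space sY"
  shows "adjoint3 sZ m x'' y'' \<in> bidual_space sZ"
proof -
  note apply2 = adjoint2_apply[OF assms(1,3) y'']
  note dual1 = adjoint1_in_dual_space[OF assms(1,3)]
  note dual2 = adjoint2_in_dual_space[OF assms(1-3) y'']
  have add: "adjoint2 m y'' (f + g) = adjoint2 m y'' f + adjoint2 m y'' g"
    if "f \<in> dual_space sZ" "g \<in> dual_space sZ" for f g
  proof (rule blinfun_eqI)
    fix x
    have "adjoint1 m (f + g) x = adjoint1 m f x + adjoint1 m g x"
      by (rule blinfun_eqI) (simp add: adjoint1_apply[OF assms(1)] blinfun.add_left)
    then show "blinfun_apply (adjoint2 m y'' (f + g)) x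
        = blinfun_apply (adjoint2 m y'' f + adjoint2 m y'' g) x"
      using that by (simp add: apply2 dual1 dual_space_add blinfun.add_left
          bidual_space_add[OF y''])
  qed
  have scale: "adjoint2 m y'' (blinfun_mult_right c o\<^sub>L f) = blinfun_mult_right c o\<^sub>L adjoint2 m y'' f"
    if "f \<in> dual_space sZ" for c f
  proof (rule blinfun_eqI)
    fix x
    have "adjoint1 m (blinfun_mult_right c o\<^sub>L f) x = blinfun_mult_right c o\<^sub>L adjoint1 m f x"
      by (rule blinfun_eqI) (simp add: adjoint1_apply[OF assms(1)])
    then show "blinfun_apply (adjoint2 m y'' (blinfun_mult_right c o\<^sub>L f)) x
        = blinfun_apply (blinfun_mult_right c o\<^sub>L adjoint2 m y'' f) x"
      using that by (simp add: apply2 dual1 dual_space_scale bidual_space_scale[OF y''])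
  qed
  obtain L where L: "L \<ge> 0"
    "\<And>z'. z' \<in> dual_space sZ \<Longrightarrow> norm (adjoint2 m y'' z') \<le> norm z' * L"
    using norm_adjoint2_le[OF assms(1,3) y''] by metis
  obtain K where K: "K \<ge> 0" "\<And>f. f \<in> dual_space sX \<Longrightarrow> norm (x'' f) \<le> norm f * K"
    using bidual_space_bounded[OF x''] by metis
  have "norm (x'' (adjoint2 m y'' z')) \<le> norm z' * (L * K)" if z': "z' \<in> dual_space sZ" for z'
  proof -
    have "norm (x'' (adjoint2 m y'' z')) \<le> norm (adjoint2 m y'' z') * K"
      by (rule K(2)[OF dual2[OF z']])
    also have "\<dots> \<le> norm z' * L * K"
      by (intro mult_right_mono L K z')
    finally show ?thesis
      by (simp add: mult_ac)
  qed
  then show ?thesis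
    unfolding bidual_space_def[of sZ] adjoint3_def
    by (auto simp: dual_space_add dual_space_scale add scale bidual_space_add[OF x'']
        bidual_space_scale[OF x''] dual2)
qed

section \<open>Weak and weak-star convergence through evaluations\<close>

text \<open>Open sets of the pullback are preimages cut down to \<open>S\<close>; eventual
  membership in \<open>S\<close> takes care of the cut.\<close>

lemma limitin_pullback_topology:
  assumes "l \<in> S" "\<forall>\<^sub>F x in F. g x \<in> S" "limitin T (\<lambda>x. f (g x)) (f l) F"
  shows "limitin (pullback_topology S f T) g l F"
  unfolding limitin_def
proof (intro conjI allI impI)
  show "l \<in> topspace (pullback_topology S f T)"
    using assms(1,3) by (auto simp: topspace_pullback_topology limitin_def)
  fix U assume "openin (pullback_topology S f T) U \<and> l \<in> U"
  then obtain V where V: "openin T V" "U = f -` V \<inter> S" "l \<in> U"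
    by (auto simp: openin_pullback_topology)
  then have "\<forall>\<^sub>F x in F. f (g x) \<in> V"
    using assms(3) by (auto simp: limitin_def)
  with assms(2) show "\<forall>\<^sub>F x in F. g x \<in> U"
    by eventually_elim (auto simp: V(2))
qed

lemma limitin_weak_star_dual:
  assumes "l \<in> dual_space sc" "\<forall>\<^sub>F x in F. g x \<in> dual_space sc"
    and "\<And>v. ((\<lambda>x. blinfun_apply (g x) v) \<longlongrightarrow> blinfun_apply l v) F"
  shows "limitin (weak_star_dual sc) g l F"
  unfolding weak_star_dual_def using assms
  by (intro limitin_pullback_topology) (auto simp: limitin_componentwise)

text \<open>On \<open>dual_space sc\<close>, evaluation by \<phi> is the embedding that defines
  \<open>weak_dual\<close> followed by the projection to coordinate \<phi>, hence
  continuous.\<close>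

lemma limitin_weak_dual_bidual_space:
  assumes "limitin (weak_dual sc) g l F" "\<phi> \<in> bidual_space sc"
  shows "((\<lambda>x. \<phi> (g x)) \<longlongrightarrow> \<phi> l) F"
proof -
  have "continuous_map (weak_dual sc) euclidean
      ((\<lambda>h. h \<phi>) \<circ> (\<lambda>f. \<lambda>\<phi>\<in>bidual_space sc. \<phi> f))"
    unfolding weak_dual_def using assms(2)
    by (intro continuous_map_pullback continuous_map_product_projection)
  then have "continuous_map (weak_dual sc) euclidean \<phi>"
    using assms(2) by (simp add: comp_def)
  from continuous_map_limit[OF this assms(1)] show ?thesis
    by (simp add: comp_def)
qed

section \<open>Weak-star continuity of the third adjoint\<close>

text \<open>The element of the algebra enters through the operator \<open>T\<close> on X alone, so
  that all four cases of the theorem become instances. \<open>T\<close> and \<open>m\<close> are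
  linked only by sharing the space X.\<close>

lemma topological_center_eq_bidual_space:
  assumes m: "bounded_bilinear m" "\<And>c x y. m (sX c x) y = sZ c (m x y)"
    "\<And>c x y. m x (sY c y) = sZ c (m x y)"
    and T: "\<And>c x. blinfun_apply T (sX c x) = sX c (blinfun_apply T x)"
    and surj: "\<And>x''. x'' \<in> bidual_space sX \<Longrightarrow>
      \<exists>w''\<in>bidual_space sX. \<forall>x'\<in>dual_space sX. x'' x' = w'' (x' o\<^sub>L T)"
    and wsw: "\<And>F. \<forall>\<^sub>F x' in F. x' \<in> dual_space sX \<Longrightarrow>
      limitin (weak_star_dual sX) (\<lambda>x'. x' o\<^sub>L T) 0 F \<Longrightarrow>
      limitin (weak_dual sX) (\<lambda>x'. x' o\<^sub>L T) 0 F"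
  shows "topological_center sX sY sZ m = bidual_space sX"
proof -
  have dual_T: "x' o\<^sub>L T \<in> dual_space sX" if "x' \<in> dual_space sX" for x'
    using that by (simp add: dual_space_def T)
  have topspace: "topspace (weak_star_bidual sY) = bidual_space sY"
    by (auto simp: weak_star_bidual_def bidual_space_def PiE_def)
  have "continuous_map (weak_star_bidual sY) (weak_star_bidual sZ) (adjoint3 sZ m x'')"
    if x'': "x'' \<in> bidual_space sX" for x''
  proof -
    obtain w'' where w'': "w'' \<in> bidual_space sX"
      and x''_eq: "\<And>x'. x' \<in> dual_space sX \<Longrightarrow> x'' x' = w'' (x' o\<^sub>L T)"
      using surj[OF x''] by blast
    \<comment> \<open>The weak-star topology of Z** is coordinatewise, so one \<open>z'\<close> is
      treated at a time.\<close>
    have cont: "continuous_map (weak_star_bidual sY) euclidean (\<lambda>y''. x'' (adjoint2 m y'' z'))"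
      if z': "z' \<in> dual_space sZ" for z'
      unfolding continuous_map_atin topspace
    proof
      fix y0 assume y0: "y0 \<in> bidual_space sY"
      \<comment> \<open>The filter of punctured neighbourhoods of \<open>y0\<close> replaces a net
        converging to \<open>y0\<close>.\<close>
      define F where "F = atin (weak_star_bidual sY) y0"
      \<comment> \<open>\<open>wsw\<close> speaks of null nets, so the limit is subtracted.\<close>
      define h where "h y'' = adjoint2 m y'' z' - adjoint2 m y0 z'" for y''
      note dual1 = adjoint1_in_dual_space[OF m(1,3) z']
      note dual2 = adjoint2_in_dual_space[OF m _ z']
      note apply2 = adjoint2_apply[OF m(1,3) _ z']
      have ev: "\<forall>\<^sub>F y'' in F. y'' \<in> bidual_space sY"
        unfolding F_def eventually_atin
        by (metis DiffD1 openin_topspace topspace y0)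
      then have ev_h: "\<forall>\<^sub>F y'' in F. h y'' \<in> dual_space sX"
        by eventually_elim (auto simp: h_def intro!: dual_space_diff dual2 y0)
      have eval: "((\<lambda>y''. y'' y') \<longlongrightarrow> y0 y') F" if "y' \<in> dual_space sY" for y'
      proof -
        have "continuous_map (weak_star_bidual sY) euclidean (\<lambda>y''. y'' y')"
          unfolding weak_star_bidual_def using that
          by (intro continuous_map_from_subtopology continuous_map_product_projection)
        then show ?thesis
          using y0 by (simp add: continuous_map_atin topspace F_def)
      qed
      \<comment> \<open>At \<open>v\<close> the functional is the difference of \<open>y''\<close>
        and \<open>y0\<close> at the fixed element \<open>adjoint1 m z' (T v)\<close> of Y*, which
        weak-star convergence sends to 0.\<close>
      have "((\<lambda>y''. blinfun_apply (h y'' o\<^sub>L T) v) \<longlongrightarrow> blinfun_apply 0 v) F" for v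
      proof -
        let ?y' = "adjoint1 m z' (blinfun_apply T v)"
        have "((\<lambda>y''. y'' ?y' - y0 ?y') \<longlongrightarrow> y0 ?y' - y0 ?y') F"
          by (intro tendsto_intros eval dual1)
        moreover have "\<forall>\<^sub>F y'' in F. y'' ?y' - y0 ?y' = blinfun_apply (h y'' o\<^sub>L T) v"
          using ev by eventually_elim (simp add: h_def blinfun.diff_left apply2 y0)
        ultimately show ?thesis
          by (simp add: tendsto_cong)
      qed
      then have "limitin (weak_star_dual sX) (\<lambda>y''. h y'' o\<^sub>L T) 0 F"
        using ev_h by (intro limitin_weak_star_dual zero_in_dual_space)
          (auto elim!: eventually_mono intro: dual_T)
      \<comment> \<open>\<open>wsw\<close> quantifies over filters on X*, so \<open>F\<close> is
        pushed forward along \<open>h\<close>.\<close>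
      then have "limitin (weak_star_dual sX) (\<lambda>x'. x' o\<^sub>L T) 0 (filtermap h F)"
        by (simp add: limitin_def eventually_filtermap)
      moreover have "\<forall>\<^sub>F x' in filtermap h F. x' \<in> dual_space sX"
        using ev_h by (simp add: eventually_filtermap)
      ultimately have "limitin (weak_dual sX) (\<lambda>x'. x' o\<^sub>L T) 0 (filtermap h F)"
        by (rule wsw[rotated])
      from limitin_weak_dual_bidual_space[OF this w'']
      have "((\<lambda>y''. w'' (h y'' o\<^sub>L T)) \<longlongrightarrow> 0) F"
        by (simp add: filterlim_filtermap bidual_space_zero[OF w''])
      \<comment> \<open>The factorization of \<open>x''\<close> through \<open>T\<close> is
        available on \<open>dual_space sX\<close> only, hence the appeal to \<open>ev_h\<close>;
        linearity of \<open>x''\<close> then splits the difference.\<close>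
      moreover have "\<forall>\<^sub>F y'' in F. w'' (h y'' o\<^sub>L T)
          = x'' (adjoint2 m y'' z') - x'' (adjoint2 m y0 z')"
        using ev ev_h
      proof eventually_elim
        case (elim y'')
        have "w'' (h y'' o\<^sub>L T) = x'' (h y'')"
          by (rule x''_eq[symmetric, OF elim(2)])
        then show ?case
          by (simp add: h_def bidual_space_diff[OF x''] dual2 elim(1) y0)
      qed
      ultimately have "((\<lambda>y''. x'' (adjoint2 m y'' z') - x'' (adjoint2 m y0 z')) \<longlongrightarrow> 0) F"
        by (simp add: tendsto_cong)
      then show "limitin euclidean (\<lambda>y''. x'' (adjoint2 m y'' z')) (x'' (adjoint2 m y0 z'))
          (atin (weak_star_bidual sY) y0)"
        by (simp add: F_def Lim_null[symmetric])
    qed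
    have bidual: "adjoint3 sZ m x'' y'' \<in> bidual_space sZ" if "y'' \<in> bidual_space sY" for y''
      by (rule adjoint3_in_bidual_space[OF m x'' that])
    show ?thesis
      \<comment> \<open>Continuity splits into its coordinates, given by \<open>cont\<close>, and
        the range condition of the subtopology, given by \<open>bidual\<close>.\<close>
      unfolding weak_star_bidual_def[of sZ] continuous_map_in_subtopology
        continuous_map_componentwise
      using cont bidual by (auto simp: topspace adjoint3_def)
  qed
  then show ?thesis
    by (auto simp: topological_center_def)
qed

section \<open>Multiplication by a fixed element as the operator \<open>T\<close>\<close>

lemma dual_ract_eq_compose:
  assumes "bounded_bilinear lact"
  shows "dual_ract lact b' a = b' o\<^sub>L Blinfun (lact a)"
proof (rule blinfun_eqI)
  \<comment> \<open>Both sides unfold to the same \<open>Blinfun\<close> term, so the evaluation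
    rule for the first adjoint carries over.\<close>
  have "dual_ract lact b' a = adjoint1 lact b' a"
    by (simp add: dual_ract_def adjoint1_def)
  then show "blinfun_apply (dual_ract lact b' a) b = blinfun_apply (b' o\<^sub>L Blinfun (lact a)) b"
    for b
    by (simp add: adjoint1_apply[OF assms] bounded_linear_Blinfun_apply
        bounded_bilinear.bounded_linear_right[OF assms])
qed

text \<open>With \<open>T\<close> the left multiplication by \<open>a\<close>,
  \<open>bidual_lact\<close> is composition with the adjoint of \<open>T\<close>, so
  \<open>surj\<close> supplies the factorization and the \<open>Rwsw_property\<close> is
  \<open>wsw\<close>.\<close>

lemma topological_center_eq_bidual_space_if_Rwsw:
  assumes "bounded_bilinear m" "\<And>c x y. m (sX c x) y = sZ c (m x y)"
    "\<And>c x y. m x (sY c y) = sZ c (m x y)"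
    and lact: "bounded_bilinear lact" "\<And>c x. lact a (sX c x) = sX c (lact a x)"
    and surj: "bidual_space sX = bidual_lact sX lact a ` bidual_space sX"
    and "Rwsw_property sX lact a"
  shows "topological_center sX sY sZ m = bidual_space sX"
proof (rule topological_center_eq_bidual_space[where m = m and sX = sX and sY = sY and sZ = sZ
      and T = "Blinfun (lact a)", OF assms(1-3)])
  show "blinfun_apply (Blinfun (lact a)) (sX c x) = sX c (blinfun_apply (Blinfun (lact a)) x)"
    for c x
    by (simp add: bounded_linear_Blinfun_apply bounded_bilinear.bounded_linear_right lact)
  show "\<exists>w''\<in>bidual_space sX. \<forall>x'\<in>dual_space sX. x'' x' = w'' (x' o\<^sub>L Blinfun (lact a))"
    if x'': "x'' \<in> bidual_space sX" for x''
  proof -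
    obtain w'' where "w'' \<in> bidual_space sX" "x'' = bidual_lact sX lact a w''"
      using subsetD[OF equalityD1[OF surj] x''] by blast
    then show ?thesis
      by (auto simp: bidual_lact_def dual_ract_eq_compose[OF lact(1)])
  qed
qed (use assms(7) in \<open>simp add: Rwsw_property_def dual_ract_eq_compose[OF lact(1)]\<close>)

text \<open>Swapping the arguments of \<open>ract\<close> gives a bounded bilinear map that can
  stand in for \<open>lact\<close>; the right-hand notions then unfold to the left-hand
  ones.\<close>

lemma topological_center_eq_bidual_space_if_Lwsw:
  assumes "bounded_bilinear m" "\<And>c x y. m (sX c x) y = sZ c (m x y)"
    "\<And>c x y. m x (sY c y) = sZ c (m x y)"
    and ract: "bounded_bilinear ract" "\<And>c x. ract (sX c x) a = sX c (ract x a)"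
    and surj: "bidual_space sX = (\<lambda>x''. bidual_ract sX ract x'' a) ` bidual_space sX"
    and "Lwsw_property sX ract a"
  shows "topological_center sX sY sZ m = bidual_space sX"
proof (rule topological_center_eq_bidual_space_if_Rwsw[where m = m and sX = sX and sY = sY
      and sZ = sZ and lact = "\<lambda>a x. ract x a" and a = a, OF assms(1-3)
      bounded_bilinear.flip[OF ract(1)] ract(2)])
  show "bidual_space sX = bidual_lact sX (\<lambda>a x. ract x a) a ` bidual_space sX"
    using surj unfolding bidual_lact_def bidual_ract_def dual_ract_def dual_lact_def .
  show "Rwsw_property sX (\<lambda>a x. ract x a) a"
    using assms(7) by (simp add: Rwsw_property_def Lwsw_property_def dual_ract_def dual_lact_def)
qed

theorem mainTheorem6:
  fixes scaleA :: "'k::real_normed_field \<Rightarrow> 'a::{real_normed_algebra, banach} \<Rightarrow> 'a"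
    and scaleB :: "'k \<Rightarrow> 'b::banach \<Rightarrow> 'b"
    and lact :: "'a \<Rightarrow> 'b \<Rightarrow> 'b"
    and ract :: "'b \<Rightarrow> 'a \<Rightarrow> 'b"
  assumes "banach_bimodule scaleA scaleB lact ract"
  shows
    "((\<exists>a0.
         bidual_space scaleA = bidual_lact scaleA (*) a0 ` bidual_space scaleA \<and>
           Rwsw_property scaleA (*) a0 \<or>
         bidual_space scaleA = (\<lambda>a''. bidual_ract scaleA (*) a'' a0) ` bidual_space scaleA \<and>
           Lwsw_property scaleA (*) a0)
      \<longrightarrow> topological_center scaleA scaleB scaleB lact = bidual_space scaleA) \<and>
     ((\<exists>a0.
         bidual_space scaleB = bidual_lact scaleB lact a0 ` bidual_space scaleB \<and>
           Rwsw_property scaleB lact a0 \<or>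
         bidual_space scaleB = (\<lambda>b''. bidual_ract scaleB ract b'' a0) ` bidual_space scaleB \<and>
           Lwsw_property scaleB ract a0)
      \<longrightarrow> topological_center scaleB scaleA scaleB ract = bidual_space scaleB)"
proof -
  interpret banach_bimodule scaleA scaleB lact ract
    by fact
  note centers = topological_center_eq_bidual_space_if_Rwsw
      topological_center_eq_bidual_space_if_Lwsw
  \<comment> \<open>Part (1) takes X = A and Y = Z = B: \<open>m\<close> is the left action on B,
    while \<open>T\<close> will be multiplication by \<open>a0\<close> inside A.\<close>
  note center_lact =
    centers[where m = lact and sX = scaleA and sY = scaleB and sZ = scaleB,
      OF bounded_bilinear_lact lact_scaleA lact_scaleB]
  \<comment> \<open>Part (2) takes X = Z = B and Y = A: \<open>m\<close> is the right action, and
    \<open>T\<close> will be the action of \<open>a0\<close> on B from either side.\<close>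
  note center_ract =
    centers[where m = ract and sX = scaleB and sY = scaleA and sZ = scaleB,
      OF bounded_bilinear_ract ract_scaleB ract_scaleA]
  show ?thesis
    \<comment> \<open>Four goals remain, two alternatives for each center, and each matches one of
      the four facts.\<close>
    by (intro conjI impI; elim exE disjE conjE)
      (fact center_lact(1)[where lact = "(*)", OF bounded_bilinear_mult A.mult_scale_right]
        center_lact(2)[where ract = "(*)", OF bounded_bilinear_mult A.mult_scale_left]
        center_ract(1)[where lact = lact, OF bounded_bilinear_lact lact_scaleB]
        center_ract(2)[where ract = ract, OF bounded_bilinear_ract ract_scaleB])+
qed

end
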